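(* Let $\mathcal{G}$ be a groupoid and $g\in\mathcal{G}$. Then the element $g^{-1}$ satisfying $\exists g^{-1}g$, $\exists gg^{-1}$, $d(g)=g^{-1}g$ and $r(g)=gg^{-1}$ is unique, and $(g^{-1})^{-1}=g$.
   Context: A groupoid is a set $\mathcal{G}$ with a partial binary operation, written by concatenation ($\exists gh$ means that $gh$ is defined). An element $e$ is an identity if $\exists eg$ implies $eg=g$ and $\exists g'e$ implies $g'e=g'$. Axioms: (i) $\exists g(hl)$ iff $\exists (gh)l$, and then $g(hl)=(gh)l$; (ii) $\exists g(hl)$ iff $\exists gh$ and $\exists hl$; (iii) for each $g$ there are unique identities $d(g),r(g)$ with $\exists gd(g)$ and $\exists r(g)g$; (iv) for each $g$ there is an element $g^{-1}$ with $\exists g^{-1}g$, $\exists gg^{-1}$, $d(g)=g^{-1}g$, $r(g)=gg^{-1}$. *)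

theory Defs
  imports Main
begin

text \<open>
  A partial binary operation on a set \<open>G\<close> is a function \<open>m\<close> with values in an option type:
  \<open>m g h = Some k\<close> means that the product of \<open>g\<close> and \<open>h\<close> is defined and equals \<open>k\<close>, and
  \<open>m g h = None\<close> means that it is undefined. Only the values of \<open>m\<close> at elements of \<open>G\<close> matter.
  A nested product is defined when both the inner and the outer product are, which is what
  \<open>Option.bind\<close> expresses.
\<close>

type_synonym 'a partial_op = "'a \<Rightarrow> 'a \<Rightarrow> 'a option"

definition defined :: "'a option \<Rightarrow> bool" where
  "defined x \<longleftrightarrow> x \<noteq> None"

definition mult_right :: "'a partial_op \<Rightarrow> 'a \<Rightarrow> 'a \<Rightarrow> 'a \<Rightarrow> 'a option" where
  "mult_right m g h l = Option.bind (m h l) (\<lambda>k. m g k)"  \<comment> \<open>\<open>g(hl)\<close>\<close>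

definition mult_left :: "'a partial_op \<Rightarrow> 'a \<Rightarrow> 'a \<Rightarrow> 'a \<Rightarrow> 'a option" where
  "mult_left m g h l = Option.bind (m g h) (\<lambda>k. m k l)"  \<comment> \<open>\<open>(gh)l\<close>\<close>

definition is_identity :: "'a set \<Rightarrow> 'a partial_op \<Rightarrow> 'a \<Rightarrow> bool" where
  "is_identity G m e \<longleftrightarrow> e \<in> G \<and>
     (\<forall>g\<in>G. defined (m e g) \<longrightarrow> m e g = Some g) \<and>
     (\<forall>g\<in>G. defined (m g e) \<longrightarrow> m g e = Some g)"

text \<open>The descriptions below are meaningful for \<open>g \<in> G\<close> in a groupoid.\<close>

definition dom_id :: "'a set \<Rightarrow> 'a partial_op \<Rightarrow> 'a \<Rightarrow> 'a" where
  "dom_id G m g = (THE e. is_identity G m e \<and> defined (m g e))"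

definition ran_id :: "'a set \<Rightarrow> 'a partial_op \<Rightarrow> 'a \<Rightarrow> 'a" where
  "ran_id G m g = (THE e. is_identity G m e \<and> defined (m e g))"

definition is_inverse :: "'a set \<Rightarrow> 'a partial_op \<Rightarrow> 'a \<Rightarrow> 'a \<Rightarrow> bool" where
  "is_inverse G m g h \<longleftrightarrow> h \<in> G \<and>
     defined (m h g) \<and> defined (m g h) \<and>
     m h g = Some (dom_id G m g) \<and> m g h = Some (ran_id G m g)"

definition inverse_of :: "'a set \<Rightarrow> 'a partial_op \<Rightarrow> 'a \<Rightarrow> 'a" where
  "inverse_of G m g = (THE h. is_inverse G m g h)"

locale groupoid =
  fixes G :: "'a set" and m :: "'a partial_op"
  assumes closed: "\<lbrakk>g \<in> G; h \<in> G; m g h = Some k\<rbrakk> \<Longrightarrow> k \<in> G"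
    and assoc_defined: "\<lbrakk>g \<in> G; h \<in> G; l \<in> G\<rbrakk> \<Longrightarrow>
          defined (mult_right m g h l) \<longleftrightarrow> defined (mult_left m g h l)"
    and assoc: "\<lbrakk>g \<in> G; h \<in> G; l \<in> G; defined (mult_right m g h l)\<rbrakk> \<Longrightarrow>
          mult_right m g h l = mult_left m g h l"
    and defined_iff: "\<lbrakk>g \<in> G; h \<in> G; l \<in> G\<rbrakk> \<Longrightarrow>
          defined (mult_right m g h l) \<longleftrightarrow> defined (m g h) \<and> defined (m h l)"
    and ex1_dom: "g \<in> G \<Longrightarrow> \<exists>!e. is_identity G m e \<and> defined (m g e)"
    and ex1_ran: "g \<in> G \<Longrightarrow> \<exists>!e. is_identity G m e \<and> defined (m e g)"
    and ex_inverse: "g \<in> G \<Longrightarrow> \<exists>h. is_inverse G m g h"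

end

theory Submission
  imports Defs
begin

text \<open>
  Two inverses \<open>h\<close> and \<open>h'\<close> of \<open>g\<close> agree by the argument familiar from monoids: the
  triple product \<open>h g h'\<close> is \<open>h r(g) = h\<close> when bracketed to the right and \<open>d(g) h' = h'\<close>
  when bracketed to the left. It exists because \<open>hg\<close> and \<open>gh'\<close> do.

  The case \<open>h = h'\<close> also says that \<open>h r(g)\<close> and \<open>d(g) h\<close> exist. The identities that can be
  multiplied to \<open>h\<close> are unique, so \<open>d(h) = r(g)\<close> and \<open>r(h) = d(g)\<close>: the conditions on
  \<open>h\<close> to be inverse to \<open>g\<close> are then those on \<open>g\<close> to be inverse to \<open>h\<close>. Being an inverse is thus
  a symmetric relation, and \<open>(g\<^sup>-\<^sup>1)\<^sup>-\<^sup>1 = g\<close> follows from uniqueness.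
\<close>

context groupoid
begin

lemma dom_id_identity: "g \<in> G \<Longrightarrow> is_identity G m (dom_id G m g)"
  unfolding dom_id_def using theI'[OF ex1_dom] by blast

lemma ran_id_identity: "g \<in> G \<Longrightarrow> is_identity G m (ran_id G m g)"
  unfolding ran_id_def using theI'[OF ex1_ran] by blast

lemma dom_id_eqI:
  assumes "g \<in> G" "is_identity G m e" "defined (m g e)"
  shows "dom_id G m g = e"
  unfolding dom_id_def using the1_equality[OF ex1_dom] assms by blast

lemma ran_id_eqI:
  assumes "g \<in> G" "is_identity G m e" "defined (m e g)"
  shows "ran_id G m g = e"
  unfolding ran_id_def using the1_equality[OF ex1_ran] assms by blast

text \<open>
  The two bracketings of \<open>h g h'\<close>. The inverses are kept distinct because uniqueness compares
  them, while symmetry uses the case \<open>h = h'\<close>.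
\<close>

lemma inverse_triple_product:
  assumes g: "g \<in> G" and h: "is_inverse G m g h" and h': "is_inverse G m g h'"
  shows "m h (ran_id G m g) = Some h" "m (dom_id G m g) h' = Some h'" "h = h'"
proof -
  have G: "h \<in> G" "h' \<in> G"
    and hg: "m h g = Some (dom_id G m g)" and gh': "m g h' = Some (ran_id G m g)"
    using h h' by (auto simp: is_inverse_def)
  have right: "mult_right m h g h' = m h (ran_id G m g)"
    by (simp add: mult_right_def gh')
  have left: "mult_left m h g h' = m (dom_id G m g) h'"
    by (simp add: mult_left_def hg)
  have ex: "defined (mult_right m h g h')"
    using defined_iff[OF G(1) g G(2)] hg gh' by (simp add: defined_def)
  have eq: "m h (ran_id G m g) = m (dom_id G m g) h'"
    using assoc[OF G(1) g G(2) ex] right left by simp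
  show 1: "m h (ran_id G m g) = Some h"
    using ran_id_identity[OF g] G(1) ex right by (simp add: is_identity_def)
  show 2: "m (dom_id G m g) h' = Some h'"
    using dom_id_identity[OF g] G(2) ex right eq by (simp add: is_identity_def)
  show "h = h'"
    using 1 2 eq by simp
qed

lemma ex1_inverse: "g \<in> G \<Longrightarrow> \<exists>!h. is_inverse G m g h"
  using ex_inverse inverse_triple_product(3) by blast

lemma inverse_of_eqI: "\<lbrakk>g \<in> G; is_inverse G m g h\<rbrakk> \<Longrightarrow> inverse_of G m g = h"
  unfolding inverse_of_def using the1_equality[OF ex1_inverse] by blast

text \<open>Passing to an inverse interchanges the two identities attached to an element.\<close>

lemma is_inverse_sym:
  assumes g: "g \<in> G" and h: "is_inverse G m g h"
  shows "is_inverse G m h g"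
proof -
  have hG: "h \<in> G"
    using h by (simp add: is_inverse_def)
  have "dom_id G m h = ran_id G m g"
    using dom_id_eqI[OF hG ran_id_identity[OF g]] inverse_triple_product(1)[OF g h h]
    by (simp add: defined_def)
  moreover have "ran_id G m h = dom_id G m g"
    using ran_id_eqI[OF hG dom_id_identity[OF g]] inverse_triple_product(2)[OF g h h]
    by (simp add: defined_def)
  ultimately show ?thesis
    using g h by (simp add: is_inverse_def defined_def)
qed

end

theorem lemma2p4:
  fixes G :: "'a set" and m :: "'a partial_op" and g :: 'a
  assumes "groupoid G m" and "g \<in> G"
  shows "(\<exists>!h. is_inverse G m g h) \<and> inverse_of G m (inverse_of G m g) = g"
proof -
  interpret groupoid G m by fact
  obtain h where h: "is_inverse G m g h"
    using ex_inverse[OF \<open>g \<in> G\<close>] by blast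
  then have "h \<in> G"
    by (simp add: is_inverse_def)
  then have "inverse_of G m h = g"
    using inverse_of_eqI is_inverse_sym[OF \<open>g \<in> G\<close> h] by blast
  then show ?thesis
    using ex1_inverse[OF \<open>g \<in> G\<close>] inverse_of_eqI[OF \<open>g \<in> G\<close> h] by simp
qed

end
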